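(* Let $d\ge 3$, $\mathcal A=\{0,1,\dots,d-1\}$, let $\varphi_d$ be the morphism $\varphi_d(i)=0(i+1)$ for $0\le i\le d-2$, $\varphi_d(d-1)=0(d-1)(d-1)$, and let $\mathbf u_d$ be its fixed point. Let $\Lambda_d$ be the spectral radius of the incidence matrix $M_{\varphi_d}$ (defined by $(M_{\varphi_d})_{ij}=|\varphi_d(j)|_i$). Then $$E^*(\mathbf u_d)=1+\frac{1}{3-\Lambda_d}.$$
   Context: The fixed point $\mathbf u_d$ is the unique infinite word starting with $0$ with $\varphi_d(\mathbf u_d)=\mathbf u_d$; $|v|_i$ is the number of occurrences of the letter $i$ in $v$. For a non-empty word $u$ and rational $e>0$ with $e|u|\in\mathbb N$, $u^e$ is the prefix of length $e|u|$ of $uuu\cdots$. The critical exponent is $E(\mathbf u)=\sup\{e: u^e\text{ factor of }\mathbf u,\ u\neq\varepsilon\}$; the asymptotic critical exponent $E^*(\mathbf u)$ is $+\infty$ if $E(\mathbf u)=+\infty$ and otherwise $\lim_{n\to\infty}\sup\{e\in\mathbb Q: u^e\text{ is a factor of }\mathbf u\text{ for some }u\text{ with }|u|\ge n\}$. *)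

theory Defs
  imports
    "HOL-Library.Stream"
    "HOL-Library.Extended_Real"
    "Jordan_Normal_Form.Spectral_Radius"
begin

text \<open>Finite words are lists and infinite words are streams. A morphism is given by the images
  of the letters; it acts on finite words by \<open>concat (map f v)\<close> and, if no image is empty, on
  infinite words by \<open>flat (smap f w)\<close>.\<close>

text \<open>The first clause is meant for the letters below \<open>d - 1\<close> and the second for the letter
  \<open>d - 1\<close>; the value at numbers outside the alphabet \<open>{..<d}\<close> is irrelevant.\<close>

definition phi :: "nat \<Rightarrow> nat \<Rightarrow> nat list" where
  "phi d i = (if i + 1 < d then [0, i + 1] else [0, d - 1, d - 1])"

definition fixed_word :: "nat \<Rightarrow> nat stream" where
  "fixed_word d = (THE w. w \<in> streams {..<d} \<and> shd w = 0 \<and> flat (smap (phi d) w) = w)"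

definition incidence_matrix :: "nat \<Rightarrow> (nat \<Rightarrow> nat list) \<Rightarrow> complex mat" where
  "incidence_matrix d f = mat d d (\<lambda>(i, j). of_nat (count_list (f j) i))"

definition is_factor :: "'a list \<Rightarrow> 'a stream \<Rightarrow> bool" where
  "is_factor v w \<longleftrightarrow> (\<exists>i. stake (length v) (sdrop i w) = v)"

text \<open>The power of \<open>u\<close> with exponent \<open>e\<close>, for a non-empty \<open>u\<close> and a positive \<open>e\<close> such that
  \<open>e * length u\<close> is a natural number.\<close>

definition frac_power :: "'a list \<Rightarrow> rat \<Rightarrow> 'a list" where
  "frac_power u e = stake (nat \<lfloor>e * of_nat (length u)\<rfloor>) (cycle u)"

definition factor_exponents :: "nat \<Rightarrow> 'a stream \<Rightarrow> rat set" where
  "factor_exponents n w =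
     {e. e > 0 \<and> (\<exists>u. u \<noteq> [] \<and> n \<le> length u \<and> e * of_nat (length u) \<in> \<nat> \<and>
                      is_factor (frac_power u e) w)}"

definition critical_exponent :: "'a stream \<Rightarrow> ereal" where
  "critical_exponent w = (SUP e \<in> factor_exponents 0 w. ereal (of_rat e))"

definition asymp_critical_exponent :: "'a stream \<Rightarrow> ereal" where
  "asymp_critical_exponent w =
     (if critical_exponent w = \<infinity> then \<infinity>
      else lim (\<lambda>n. SUP e \<in> factor_exponents n w. ereal (of_rat e)))"

text \<open>The limit and the definite description above are well defined.\<close>

lemma asymp_critical_exponent_convergent:
  "convergent (\<lambda>n. SUP e \<in> factor_exponents n w. ereal (of_rat e))"
proof (rule convergentI)
  have "antimono (\<lambda>n. SUP e \<in> factor_exponents n w. ereal (of_rat e))"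
    by (intro antimonoI SUP_subset_mono) (auto simp: factor_exponents_def intro: order_trans)
  then show "(\<lambda>n. SUP e \<in> factor_exponents n w. ereal (of_rat e))
      \<longlonglongrightarrow> (INF n. SUP e \<in> factor_exponents n w. ereal (of_rat e))"
    by (rule LIMSEQ_INF)
qed

lemma length_concat_map_phi: "2 * length v \<le> length (concat (map (phi d) v))"
  by (induction v) (auto simp: phi_def)

lemma flat_smap_phi_shift:
  "flat (smap (phi d) (v @- w)) = concat (map (phi d) v) @- flat (smap (phi d) w)"
  by (induction v) (auto simp: phi_def)

lemma fixed_word_ex1:
  assumes "d \<ge> 2"
  shows "\<exists>!w. w \<in> streams {..<d} \<and> shd w = 0 \<and> flat (smap (phi d) w) = w"
proof -
  let ?F = "\<lambda>v. concat (map (phi d) v)"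
  define W where "W n = (?F ^^ n) [0]" for n
  have W_0: "W 0 = [0]" and W_Suc: "W (Suc n) = ?F (W n)" for n
    by (simp_all add: W_def)
  have len: "n < length (W n)" for n
  proof (induction n)
    case (Suc n)
    then show ?case using length_concat_map_phi[of "W n" d] by (simp add: W_Suc)
  qed (simp add: W_0)
  have step: "\<exists>x. W (Suc n) = W n @ x" for n
  proof (induction n)
    case 0
    then show ?case using assms by (simp add: W_0 W_Suc phi_def)
  next
    case (Suc n)
    then obtain x where "W (Suc n) = W n @ x" by blast
    then have "W (Suc (Suc n)) = W (Suc n) @ ?F x" by (simp add: W_Suc)
    then show ?case by blast
  qed
  have "W (n + k) ! i = W n ! i \<and> i < length (W (n + k))" if "i < length (W n)" for n k i
  proof (induction k)
    case (Suc k)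
    obtain x where "W (Suc (n + k)) = W (n + k) @ x" using step by blast
    with Suc show ?case by (simp add: nth_append)
  qed (simp add: that)
  then have stable: "W m ! i = W n ! i" if "n \<le> m" "i < length (W n)" for m n i
    using that by (metis le_add_diff_inverse)
  have alph: "set (W n) \<subseteq> {..<d}" for n
  proof (induction n)
    case (Suc n)
    then show ?case using assms by (auto simp: W_Suc phi_def split: if_splits)
  qed (use assms in \<open>simp add: W_0\<close>)
  have decomp: "w = W n @- sdrop (length (W n)) w"
    if "\<And>i. i < length (W n) \<Longrightarrow> w !! i = W n ! i" for w n
  proof -
    have "stake (length (W n)) w = W n"
      using that by (intro nth_equalityI) simp_all
    then show ?thesis by (metis stake_sdrop)
  qed
  have eqI: "w = w'" if "\<And>i. w !! i = w' !! i" for w w' :: "nat stream"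
    using smap_alt[of id w w'] that by (simp add: stream.map_id)
  define u where "u = smap (\<lambda>n. W n ! n) nats"
  have u_nth: "u !! i = W i ! i" for i
    by (simp add: u_def)
  have u_W: "u !! i = W n ! i" if "i < length (W n)" for n i
    using stable[of i n i] stable[of n i i] that len[of i] by (cases "i \<le> n") (auto simp: u_nth)
  show ?thesis
  proof (rule ex1I[of _ u], intro conjI)
    show "u \<in> streams {..<d}"
      unfolding streams_iff_snth
    proof
      fix i
      show "u !! i \<in> {..<d}"
        using nth_mem[OF len[of i]] alph[of i] unfolding u_nth by (rule subsetD[rotated])
    qed
    show "shd u = 0"
      using u_nth[of 0] by (simp add: W_0)
    have *: "flat (smap (phi d) u) !! i = W (Suc n) ! i" if "i < length (W (Suc n))" for n i
    proof -
      have "flat (smap (phi d) u) = flat (smap (phi d) (W n @- sdrop (length (W n)) u))"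
        using decomp[OF u_W, of n] by (rule arg_cong[where f = "\<lambda>w. flat (smap (phi d) w)"])
      also have "\<dots> = W (Suc n) @- flat (smap (phi d) (sdrop (length (W n)) u))"
        by (simp only: W_Suc flat_smap_phi_shift)
      finally show ?thesis using that by (simp add: shift_snth_less)
    qed
    have "flat (smap (phi d) u) !! i = u !! i" for i
      using *[of i i] stable[of i "Suc i" i] len[of i] len[of "Suc i"] by (simp add: u_nth)
    then show "flat (smap (phi d) u) = u"
      by (intro eqI)
  next
    fix w assume w: "w \<in> streams {..<d} \<and> shd w = 0 \<and> flat (smap (phi d) w) = w"
    have w_W: "w !! i = W n ! i" if "i < length (W n)" for n i
      using that
    proof (induction n arbitrary: i)
      case 0
      then show ?case using w by (simp add: W_0)
    next
      case (Suc n)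
      then have "w = W n @- sdrop (length (W n)) w" by (intro decomp)
      then have "flat (smap (phi d) w) = flat (smap (phi d) (W n @- sdrop (length (W n)) w))"
        by (rule arg_cong[where f = "\<lambda>w. flat (smap (phi d) w)"])
      also have "\<dots> = W (Suc n) @- flat (smap (phi d) (sdrop (length (W n)) w))"
        by (simp only: W_Suc flat_smap_phi_shift)
      finally have "w = W (Suc n) @- flat (smap (phi d) (sdrop (length (W n)) w))"
        unfolding conjunct2[OF conjunct2[OF w]] .
      then show ?case using Suc.prems shift_snth_less by metis
    qed
    then have "w !! i = u !! i" for i
      using len[of i] by (simp add: u_nth)
    then show "w = u"
      by (intro eqI)
  qed
qed

end

(* A repetition of period p in the fixed point u is a factor that reoccurs at distance p, so e is
   governed by the ratio of the length m of a maximal match (a word w occurring at positions a and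
   b = a + p and extendable on neither side) to p. The letter 0 marks the beginnings of the blocks
   phi(i), hence a maximal match containing a 0 is the image of a shorter maximal match, extended
   by 0 on the right and by one more letter d-1 on each side where the two continuations are d-2
   and d-1.

   Measure words by the positive left eigenvector l of the incidence matrix with l(0) = 1 and
   eigenvalue L. If i and j are the smaller ones of the two letters on the left and on the right of
   a maximal match, then both (3 - L) l(w) + l(i) + l(j) - 1 and the weight of the period are
   multiplied by L when passing to the image. The former is at most the latter for the matches
   without a 0, hence for all, with equality along the images of the empty match around a single 0.
   So l(w) / l(period) is at most 1 / (3 - L), asymptotically attained; weights may be replaced by
   lengths because |phi^n(j)| / l(phi^n(j)) converges to a limit independent of the letter j. *)

theory Submission
  imports Defs
begin

section \<open>Blocks, letter weights and lengths of iterated images\<close>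

definition block_start :: "nat \<Rightarrow> (nat \<Rightarrow> nat) \<Rightarrow> nat \<Rightarrow> nat" where
  "block_start d u k = (\<Sum>i<k. length (phi d (u i)))"

text \<open>The recursion is the left eigenvector equation at the letters below
  \<open>d - 1\<close>, where the image \<open>0(i + 1)\<close> has weight
  \<open>1 + weight L (i + 1)\<close>. The equation at the letter \<open>d - 1\<close> becomes the
  condition \<open>L_eigen\<close> on \<open>L\<close>.\<close>

primrec weight :: "real \<Rightarrow> nat \<Rightarrow> real" where
  "weight L 0 = 1"
| "weight L (Suc i) = L * weight L i - 1"

text \<open>The length of the \<open>n\<close>-fold image of the letter \<open>j\<close>, computed
  without forming the word.\<close>

primrec iter_length :: "nat \<Rightarrow> nat \<Rightarrow> nat \<Rightarrow> nat" where
  "iter_length d 0 j = 1"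
| "iter_length d (Suc n) j = sum_list (map (iter_length d n) (phi d j))"

lemma strict_mono_between:
  fixes f :: "nat \<Rightarrow> nat"
  assumes "strict_mono f" "f 0 \<le> x"
  obtains k where "f k \<le> x" "x < f (Suc k)"
proof -
  have "\<exists>k. f k \<le> x \<and> x < f (Suc k)"
    using assms(2)
  proof (induction x rule: dec_induct)
    case base
    then show ?case using assms(1) by (auto simp: strict_mono_less)
  next
    case (step x)
    then obtain k where k: "f k \<le> x" "x < f (Suc k)" by blast
    have "f (Suc k) < f (Suc (Suc k))" using assms(1) by (simp add: strict_mono_less)
    with k show ?case by (metis Suc_leI le_SucI le_less_trans not_less)
  qed
  then show thesis using that by blast
qed

section \<open>Block structure of the fixed point\<close>

locale phi_fixed_point =
  fixes d :: nat and u :: "nat \<Rightarrow> nat"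
  assumes d_ge: "3 \<le> d"
    and u_less: "u k < d"
    and u_0: "u 0 = 0"
    and u_block: "i < length (phi d (u k)) \<Longrightarrow> u (block_start d u k + i) = phi d (u k) ! i"
begin

text \<open>Read as a map on positions, \<open>pos\<close> stands for the morphism: the letter at
  \<open>k\<close> produces the block starting at \<open>pos k\<close>, so iterating
  \<open>pos\<close> iterates \<open>phi\<close> on prefixes.\<close>

abbreviation pos :: "nat \<Rightarrow> nat" where
  "pos \<equiv> block_start d u"

lemma pos_0: "pos 0 = 0"
  by (simp add: block_start_def)

lemma pos_Suc_length: "pos (Suc k) = pos k + length (phi d (u k))"
  by (simp add: block_start_def)

lemma length_phi: "length (phi d (u k)) = (if u k = d - 1 then 3 else 2)"
  using u_less[of k] by (auto simp: phi_def)

lemma pos_Suc: "pos (Suc k) = pos k + (if u k = d - 1 then 3 else 2)"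
  by (simp add: pos_Suc_length length_phi)

lemma strict_mono_pos: "strict_mono pos"
  by (simp add: strict_mono_Suc_iff pos_Suc)

lemma pos_less_iff: "pos j < pos k \<longleftrightarrow> j < k"
  using strict_mono_pos by (rule strict_mono_less)

lemma pos_le_iff: "pos j \<le> pos k \<longleftrightarrow> j \<le> k"
  using strict_mono_pos by (rule strict_mono_less_eq)

lemma u_pos: "u (pos k) = 0"
  using u_block[of 0 k] by (simp add: phi_def split: if_splits)

lemma u_pos_1: "u (Suc (pos k)) = (if u k = d - 1 then d - 1 else Suc (u k))"
  using u_block[of 1 k] u_less[of k] by (auto simp: phi_def split: if_splits)

lemma u_pos_2: "u k = d - 1 \<Longrightarrow> u (Suc (Suc (pos k))) = d - 1"
  using u_block[of 2 k] d_ge by (auto simp: phi_def split: if_splits)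

lemma u_pos_2': "u k \<noteq> d - 1 \<Longrightarrow> u (Suc (Suc (pos k))) = 0"
  using u_pos[of "Suc k"] by (simp add: pos_Suc)

lemma pos_cases:
  obtains k where "x = pos k" | k where "x = Suc (pos k)"
  | k where "u k = d - 1" "x = Suc (Suc (pos k))"
proof -
  obtain k where "pos k \<le> x" "x < pos (Suc k)"
    using strict_mono_between[OF strict_mono_pos, of x] by (auto simp: pos_0)
  then have "x = pos k \<or> x = Suc (pos k) \<or> u k = d - 1 \<and> x = Suc (Suc (pos k))"
    by (auto simp: pos_Suc split: if_splits)
  then show thesis using that by blast
qed

lemma zero_imp_pos:
  assumes "u x = 0"
  obtains k where "x = pos k"
  using assms d_ge by (cases x rule: pos_cases) (auto simp: u_pos_1 u_pos_2 split: if_splits)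

text \<open>Every block contains just one 0, at its start, so two adjacent nonzero letters can only
  be the tail of the block \<open>0(d-1)(d-1)\<close>.\<close>

lemma nonzero_pair:
  assumes "u x \<noteq> 0" "u (Suc x) \<noteq> 0"
  shows "u x = d - 1" "u (Suc x) = d - 1" "u (Suc (Suc x)) = 0"
proof -
  have "u x = d - 1 \<and> u (Suc x) = d - 1 \<and> u (Suc (Suc x)) = 0"
    using assms
  proof (cases x rule: pos_cases)
    case (2 k)
    have "u k = d - 1" using assms 2 u_pos_2'[of k] by auto
    then show ?thesis using 2 u_pos[of "Suc k"] u_pos_1[of k] u_pos_2[of k]
      by (simp add: pos_Suc numeral_eq_Suc)
  next
    case (3 k)
    then show ?thesis using assms u_pos[of "Suc k"] by (simp add: pos_Suc numeral_eq_Suc)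
  qed (auto simp: u_pos)
  then show "u x = d - 1" "u (Suc x) = d - 1" "u (Suc (Suc x)) = 0" by auto
qed

text \<open>Serves twice: with the letter weights it yields the scaling by \<open>L\<close>, with
  \<open>iter_length\<close> the passage from \<open>n\<close> to \<open>n + 1\<close>
  iterations.\<close>

lemma sum_block: "(\<Sum>i<pos k. f (u i)) = (\<Sum>i<k. sum_list (map f (phi d (u i))))"
  for f :: "nat \<Rightarrow> 'b :: comm_monoid_add"
proof (induction k)
  case (Suc k)
  let ?n = "length (phi d (u k))"
  have "(\<Sum>i<pos (Suc k). f (u i)) = (\<Sum>i<pos k. f (u i)) + (\<Sum>i<?n. f (u (pos k + i)))"
    unfolding pos_Suc_length lessThan_atLeast0
    by (subst sum.atLeastLessThan_concat[of 0 "pos k", symmetric])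
       (simp_all add: sum.atLeastLessThan_shift_0[of _ "pos k"])
  also have "(\<Sum>i<?n. f (u (pos k + i))) = (\<Sum>i<?n. map f (phi d (u k)) ! i)"
    by (intro sum.cong) (auto simp: u_block)
  also have "\<dots> = sum_list (map f (phi d (u k)))"
    by (simp add: sum_list_sum_nth lessThan_atLeast0)
  finally show ?case by (simp add: Suc)
qed (simp add: pos_0)

text \<open>The second letter of a block determines its source, except that \<open>d - 2\<close> and
  \<open>d - 1\<close> both give \<open>d - 1\<close>. These two are told apart by the next
  position, which holds 0 or \<open>d - 1\<close>.\<close>

lemma u_eqI:
  assumes "u (Suc (pos j)) = u (Suc (pos k))" "u (Suc (Suc (pos j))) = u (Suc (Suc (pos k)))"
  shows "u j = u k"
  using assms u_pos_2[of j] u_pos_2[of k] u_pos_2'[of j] u_pos_2'[of k] d_ge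
  by (cases "u j = d - 1"; cases "u k = d - 1") (simp_all add: u_pos_1)

lemma pos_add_ge: "pos k + 2 * i \<le> pos (k + i)"
  by (induction i) (auto simp: pos_Suc)

text \<open>A tail of period \<open>b - a\<close> desubstitutes to a tail whose period is at most
  half as long, because blocks have length at least 2; this descent cannot go on.\<close>

lemma not_eventually_periodic:
  assumes "a < b"
  shows "\<exists>i. u (a + i) \<noteq> u (b + i)"
  using assms
proof (induction "b - a" arbitrary: a b rule: less_induct)
  case less
  show ?case
  proof (rule ccontr)
    assume "\<not> ?thesis"
    then have eq: "u (a + i) = u (b + i)" for i by auto
    \<comment> \<open>Among three consecutive letters one is 0, so both tails can be cut at the
      start of a block.\<close>
    have "\<exists>s. u (a + s) = 0"
      using nonzero_pair[of a] by (metis add_Suc_right add_0_right)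
    then obtain s where s: "u (a + s) = 0" by blast
    obtain a' where a': "a + s = pos a'" using s by (rule zero_imp_pos)
    obtain b' where b': "b + s = pos b'" using s eq zero_imp_pos by metis
    have lt: "a' < b'" using a' b' less.prems pos_less_iff[of a' b'] by simp
    have eq': "u (pos a' + i) = u (pos b' + i)" for i
      using eq[of "s + i"] a' b' by (simp add: add.assoc[symmetric])
    \<comment> \<open>While the two block starts keep the same offset, the letters behind them agree
      and so do the sources; equal sources in turn preserve the offset for the next block.\<close>
    have *: "u (a' + i) = u (b' + i)" if "pos (a' + i) + pos b' = pos (b' + i) + pos a'" for i
    proof -
      obtain n where n: "pos (a' + i) = pos a' + n"
        using pos_add_ge[of a' i] le_iff_add[of "pos a'" "pos (a' + i)"] by auto
      with that have "pos (b' + i) = pos b' + n" by linarith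
      with n show ?thesis using eq'[of "Suc n"] eq'[of "Suc (Suc n)"]
        by (intro u_eqI[of "a' + i" "b' + i"]) (simp_all only: add_Suc_right)
    qed
    have "pos (a' + i) + pos b' = pos (b' + i) + pos a'" for i
    proof (induction i)
      case (Suc i)
      then show ?case using *[of i] by (simp add: pos_Suc)
    qed simp
    with * have "u (a' + i) = u (b' + i)" for i by blast
    moreover have "b' - a' < b - a"
      using pos_add_ge[of a' "b' - a'"] lt a' b' by simp
    ultimately show False using less.hyps[of b' a'] lt by blast
  qed
qed

section \<open>Maximal matches\<close>

definition maximal_match :: "nat \<Rightarrow> nat \<Rightarrow> nat \<Rightarrow> bool" where
  "maximal_match a b m \<longleftrightarrow> a < b \<and> (\<forall>i<m. u (a + i) = u (b + i)) \<and> u (a + m) \<noteq> u (b + m) \<and>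
     (a = 0 \<or> u (a - 1) \<noteq> u (b - 1))"

text \<open>Aperiodicity stops the match on the right, a mismatch or position 0 on the left. The
  match may be empty, and \<open>a\<close> may be the position just behind it, which is the case
  \<open>t = m\<close>.\<close>

lemma maximal_match_extend:
  assumes "a < b"
  obtains t m where "t \<le> a" "t \<le> m" "maximal_match (a - t) (b - t) m"
proof -
  obtain n where n: "u (a + n) \<noteq> u (b + n)" "\<forall>i<n. u (a + i) = u (b + i)"
    using not_eventually_periodic[OF assms] exists_least_iff[of "\<lambda>i. u (a + i) \<noteq> u (b + i)"] by blast
  have "\<exists>t\<le>a. maximal_match (a - t) (b - t) (t + n)"
    using assms n
  proof (induction a arbitrary: b n)
    case 0
    then show ?case by (auto simp: maximal_match_def)
  next
    case (Suc a)
    obtain b' where b': "b = Suc b'" using Suc.prems by (cases b) auto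
    show ?case
    proof (cases "u a = u b'")
      case True
      have "\<exists>t\<le>a. maximal_match (a - t) (b' - t) (t + Suc n)"
        using Suc.prems True by (intro Suc.IH[of b' "Suc n"]) (auto simp: b' All_less_Suc2)
      then obtain t where "t \<le> a" "maximal_match (a - t) (b' - t) (t + Suc n)" by blast
      then show ?thesis by (intro exI[of _ "Suc t"]) (auto simp: b')
    next
      case False
      then have "maximal_match (Suc a) b n" using Suc.prems b' by (auto simp: maximal_match_def)
      then show ?thesis by (intro exI[of _ 0]) auto
    qed
  qed
  then show thesis using that by (metis le_add1)
qed

text \<open>If one of the matches started later, the pair of letters before its start would lie
  inside the other match and agree, against maximality. This serves to identify a given match with
  the image of a shorter one.\<close>

lemma maximal_match_unique:
  assumes "maximal_match a b m" "maximal_match a' b' m'"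
    and "a + s = a' + s'" "b + s = b' + s'" "s \<le> m" "s' \<le> m'"
  shows "a = a'" "b = b'" "m = m'"
proof -
  have *: "a' \<le> a" if mm: "maximal_match a b m" "maximal_match a' b' m'"
    and s: "a + s = a' + s'" "b + s = b' + s'" "s \<le> m" "s' \<le> m'" for a b m s a' b' m' s'
  proof (rule ccontr)
    assume "\<not> a' \<le> a"
    define i where "i = a' - Suc a"
    have i: "a' = a + Suc i" "b' = b + Suc i" "i < m" using \<open>\<not> a' \<le> a\<close> s by (auto simp: i_def)
    then show False using mm by (auto simp: maximal_match_def)
  qed
  have a: "a = a'" using *[OF assms] *[OF assms(2,1) assms(3,4)[symmetric] assms(6,5)] by simp
  with assms(3) have "s = s'" by simp
  with a assms show "a = a'" "b = b'" by auto
  with assms show "m = m'" unfolding maximal_match_def by (metis linorder_neqE_nat)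
qed

text \<open>Equal letters have equal blocks, so both copies grow alike; \<open>n\<close> is the
  length of the image of the matched word.\<close>

lemma match_image:
  assumes "\<And>i. i < m \<Longrightarrow> u (a + i) = u (b + i)"
  obtains n where "pos (a + m) = pos a + n" "pos (b + m) = pos b + n" "m \<le> n"
    "\<And>i. i < n \<Longrightarrow> u (pos a + i) = u (pos b + i)"
  using assms
proof (induction m arbitrary: thesis)
  case 0
  show ?case by (rule 0(1)[of 0]) simp_all
next
  case (Suc m)
  obtain n where n: "pos (a + m) = pos a + n" "pos (b + m) = pos b + n" "m \<le> n"
      "\<And>i. i < n \<Longrightarrow> u (pos a + i) = u (pos b + i)"
    using Suc.IH Suc.prems(2) by (metis less_SucI)
  let ?l = "length (phi d (u (a + m)))"
  have eq: "u (b + m) = u (a + m)" using Suc.prems(2)[of m] by simp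
  have "u (pos a + i) = u (pos b + i)" if "i < n + ?l" for i
  proof (cases "i < n")
    case False
    then obtain j where "i = n + j" by (metis le_add_diff_inverse not_less)
    with that show ?thesis
      using u_block[of j "a + m"] u_block[of j "b + m"] by (simp add: n eq add.assoc)
  qed (rule n(4))
  moreover have "1 \<le> ?l" by (simp add: length_phi)
  then have "Suc m \<le> n + ?l" using n(3) by linarith
  ultimately show ?case
    using n(1-3) eq by (intro Suc.prems(1)[of "n + ?l"]) (simp_all add: pos_Suc_length)
qed

end

section \<open>Letter weights as a left eigenvector\<close>

locale phi_weight = phi_fixed_point +
  fixes L :: real
  assumes L_gt: "2 < L" and L_less: "L < 3" and L_eigen: "(L - 2) * weight L (d - 1) = 1"
begin

abbreviation w :: "nat \<Rightarrow> real" where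
  "w \<equiv> weight L"

definition S :: "nat \<Rightarrow> real" where
  "S x = (\<Sum>i<x. w (u i))"

lemma S_Suc: "S (Suc x) = S x + w (u x)"
  by (simp add: S_def)

lemma w_ge_1: "1 \<le> w i"
proof (induction i)
  case (Suc i)
  moreover from this have "2 * w i \<le> L * w i" using L_gt by (intro mult_right_mono) simp_all
  ultimately show ?case unfolding weight.simps by linarith
qed simp

lemma w_mono: "i \<le> j \<Longrightarrow> w i \<le> w j"
proof (induction j rule: dec_induct)
  case (step j)
  have "2 * w j \<le> L * w j" using L_gt w_ge_1[of j] by (intro mult_right_mono) simp_all
  with step(3) w_ge_1[of j] show ?case unfolding weight.simps by linarith
qed simp

lemma w_le_last: "w (u x) \<le> w (d - 1)"
  using u_less[of x] by (intro w_mono) simp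

lemma w_block: "j < d \<Longrightarrow> sum_list (map w (phi d j)) = L * w j"
  using L_eigen by (cases "j = d - 1") (auto simp: phi_def algebra_simps)

lemma S_pos: "S (pos k) = L * S k"
  by (simp add: S_def sum_block w_block u_less sum_distrib_left)

lemma S_diff_bounds:
  assumes "x \<le> y"
  shows "real (y - x) \<le> S y - S x" "S y - S x \<le> w (d - 1) * real (y - x)"
proof -
  have "real (y - x) \<le> S y - S x \<and> S y - S x \<le> w (d - 1) * real (y - x)"
    using assms
  proof (induction y rule: dec_induct)
    case (step y)
    then show ?case using w_ge_1[of "u y"] w_le_last[of y]
      by (auto simp: S_Suc Suc_diff_le algebra_simps)
  qed simp
  then show "real (y - x) \<le> S y - S x" "S y - S x \<le> w (d - 1) * real (y - x)" by auto
qed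

lemma S_mono: "x \<le> y \<Longrightarrow> S x \<le> S y"
  using S_diff_bounds(1)[of x y] by simp

section \<open>How the two ends of a match change under the morphism\<close>

lemma last_eq: "L * w (d - 1) = 2 * w (d - 1) + 1"
  using L_eigen by (simp add: algebra_simps)

text \<open>These are the only two distinct letters whose images agree beyond the initial 0, and
  also the only ones whose images end alike. The names \<open>f\<close> and \<open>Suc f\<close>
  avoid natural subtraction.\<close>

lemma last_letters:
  assumes "{u x, u y} = {d - 2, d - 1}"
  obtains f where "d - 1 = Suc f" "0 < f" "u x = f \<and> u y = Suc f \<or> u x = Suc f \<and> u y = f"
    "w (Suc f) = L * w f - 1" "L * w (Suc f) = 2 * w (Suc f) + 1"
proof -
  have f: "d - 1 = Suc (d - 2)" "0 < d - 2" using d_ge by auto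
  have "L * w (Suc (d - 2)) = 2 * w (Suc (d - 2)) + 1"
    using last_eq by (simp only: f(1))
  with assms f show thesis
    by (intro that[of "d - 2"]) (auto simp: doubleton_eq_iff)
qed

text \<open>The two images share the initial 0, and for the letters \<open>d - 2\<close> and
  \<open>d - 1\<close> they share \<open>0(d-1)\<close>, after which 0 stands against
  \<open>d - 1\<close>. The eigenvector equations make both cases obey the same law.\<close>

lemma right_image:
  assumes "u x \<noteq> u y"
  obtains e where "0 < e" "\<And>i. i < e \<Longrightarrow> u (pos x + i) = u (pos y + i)"
    "u (pos x + e) \<noteq> u (pos y + e)"
    "(3 - L) * (S (pos x + e) - S (pos x)) + w (min (u (pos x + e)) (u (pos y + e)))
       = L * w (min (u x) (u y)) + 2 - L"
proof (cases "{u x, u y} = {d - 2, d - 1}")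
  case True
  then obtain f where f: "d - 1 = Suc f" "0 < f"
      "u x = f \<and> u y = Suc f \<or> u x = Suc f \<and> u y = f"
      "w (Suc f) = L * w f - 1" "L * w (Suc f) = 2 * w (Suc f) + 1"
    by (rule last_letters)
  have "u (Suc (pos x)) = Suc f" "u (Suc (pos y)) = Suc f"
    using f(1,3) by (auto simp: u_pos_1)
  moreover have "u (Suc (Suc (pos x))) = 0 \<and> u (Suc (Suc (pos y))) = Suc f \<or>
      u (Suc (Suc (pos x))) = Suc f \<and> u (Suc (Suc (pos y))) = 0"
    using f(1,3) u_pos_2[of x] u_pos_2'[of x] u_pos_2[of y] u_pos_2'[of y] by auto
  moreover have "min (u x) (u y) = f" using f(3) by auto
  moreover have "(3 - L) * (1 + w (Suc f)) = 3 - L + 3 * w (Suc f) - L * w (Suc f)"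
    by (simp add: algebra_simps del: weight.simps(2))
  then have "(3 - L) * (1 + w (Suc f)) + 1 = L * w f + 2 - L" using f(4,5) by linarith
  moreover have "S (pos x + 2) - S (pos x) = 1 + w (Suc f)"
    using calculation(1) by (simp add: numeral_2_eq_2 S_Suc u_pos del: weight.simps(2))
  ultimately show ?thesis
    by (intro that[of 2]) (auto simp: less_2_cases_iff u_pos simp del: weight.simps(2))
next
  case False
  then have "u (Suc (pos x)) \<noteq> u (Suc (pos y))"
    using assms u_less[of x] u_less[of y] by (auto simp: u_pos_1 insert_commute numeral_2_eq_2)
  moreover have "min (u (Suc (pos x))) (u (Suc (pos y))) = Suc (min (u x) (u y))"
    using assms u_less[of x] u_less[of y] by (auto simp: u_pos_1 min_def)
  ultimately show ?thesis
    by (intro that[of 1]) (simp_all add: u_pos S_Suc algebra_simps)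
qed

text \<open>Here \<open>s\<close> counts the letters gained on the left: 1 for \<open>d - 2\<close>
  and \<open>d - 1\<close>, whose images both end in \<open>d - 1\<close>, and 0 otherwise. By the
  last equation both copies gain the same weight, so the weight of the period is just multiplied by
  \<open>L\<close>.\<close>

lemma left_image:
  assumes "u x \<noteq> u y"
  obtains s where "s \<le> 1" "s = 1 \<Longrightarrow> u (pos (Suc x) - 1) = u (pos (Suc y) - 1)"
    "u (pos (Suc x) - s - 1) \<noteq> u (pos (Suc y) - s - 1)"
    "(3 - L) * (S (pos (Suc x)) - S (pos (Suc x) - s))
       + w (min (u (pos (Suc x) - s - 1)) (u (pos (Suc y) - s - 1))) = L * w (min (u x) (u y)) - 1"
    "S (pos (Suc x)) - S (pos (Suc x) - s) = S (pos (Suc y)) - S (pos (Suc y) - s)"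
proof -
  have last: "u (pos (Suc z) - 1) = (if u z = d - 1 then d - 1 else Suc (u z))" for z
    by (simp add: pos_Suc numeral_eq_Suc u_pos_1 u_pos_2)
  show thesis
  proof (cases "{u x, u y} = {d - 2, d - 1}")
    case True
    then obtain f where f: "d - 1 = Suc f" "0 < f"
        "u x = f \<and> u y = Suc f \<or> u x = Suc f \<and> u y = f"
        "w (Suc f) = L * w f - 1" "L * w (Suc f) = 2 * w (Suc f) + 1"
      by (rule last_letters)
    have last_f: "u (pos (Suc x) - 1) = Suc f" "u (pos (Suc y) - 1) = Suc f"
      using f(1,3) last[of x] last[of y] by auto
    have S_last: "S (pos (Suc z)) - S (pos (Suc z) - 1) = w (u (pos (Suc z) - 1))" for z
      using S_Suc[of "pos (Suc z) - 1"] by (simp add: pos_Suc split: if_splits)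
    have "u (pos (Suc z) - 1 - 1) = (if u z = d - 1 then d - 1 else 0)" for z
      by (simp add: pos_Suc numeral_eq_Suc u_pos_1 u_pos)
    then have "u (pos (Suc x) - 1 - 1) = 0 \<and> u (pos (Suc y) - 1 - 1) = Suc f \<or>
        u (pos (Suc x) - 1 - 1) = Suc f \<and> u (pos (Suc y) - 1 - 1) = 0"
      using f(1,3) by auto
    moreover have "min (u x) (u y) = f" using f(3) by auto
    moreover have "(3 - L) * w (Suc f) + 1 = L * w f - 1"
      using f(4,5) by (simp add: left_diff_distrib del: weight.simps(2))
    ultimately show thesis
      using last_f S_last[of x] S_last[of y]
      by (intro that[of 1]) (auto simp del: weight.simps(2) One_nat_def)
  next
    case False
    have "u (pos (Suc x) - 1) \<noteq> u (pos (Suc y) - 1)"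
      using assms False u_less[of x] u_less[of y] last[of x] last[of y]
      by (auto simp: insert_commute numeral_2_eq_2 split: if_splits)
    moreover have "min (u (pos (Suc x) - 1)) (u (pos (Suc y) - 1)) = Suc (min (u x) (u y))"
      using assms u_less[of x] u_less[of y] last[of x] last[of y]
      by (auto simp: min_def split: if_splits)
    ultimately show thesis
      by (intro that[of 0]) (simp_all only: diff_zero diff_self mult_zero_right weight.simps, simp_all)
  qed
qed

text \<open>A match starting at position 0 has no letter on its left. The value \<open>1 / (L - 1)\<close> is the
  fixed point of \<open>x \<mapsto> L * x - 1\<close>, the rule by which the left weight changes under \<open>phi\<close>.\<close>

definition left_weight :: "nat \<Rightarrow> nat \<Rightarrow> real" where
  "left_weight a b = (if a = 0 then 1 / (L - 1) else w (min (u (a - 1)) (u (b - 1))))"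

section \<open>The excess of a match and its scaling under the morphism\<close>

lemma left_weight_nonneg: "0 \<le> left_weight a b"
  using L_gt order_trans[OF zero_le_one w_ge_1] by (simp add: left_weight_def)

text \<open>The final \<open>- 1\<close> removes any additive term from the scaling: together with
  the corrections \<open>- 1\<close> on the left and \<open>2 - L\<close> on the right it becomes
  \<open>- L\<close>.\<close>

definition excess :: "nat \<Rightarrow> nat \<Rightarrow> nat \<Rightarrow> real" where
  "excess a b m =
     (3 - L) * (S (a + m) - S a) + left_weight a b + w (min (u (a + m)) (u (b + m))) - 1"

text \<open>The image of the matched word grows by \<open>s\<close> letters on the left and at least
  one on the right, whence the strict inequality. The last conclusion keeps a left neighbour
  available along a whole sequence of images.\<close>

lemma maximal_match_image:
  assumes "maximal_match a b m"
  obtains a' b' m' s where "maximal_match a' b' m'" "pos a = a' + s" "pos b = b' + s"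
    "s + (pos (a + m) - pos a) < m'" "excess a' b' m' = L * excess a b m"
    "S b' - S a' = L * (S b - S a)" "0 < a \<Longrightarrow> 0 < a'"
proof -
  have mm: "a < b" "u (a + m) \<noteq> u (b + m)" "a = 0 \<or> u (a - 1) \<noteq> u (b - 1)"
      "i < m \<Longrightarrow> u (a + i) = u (b + i)" for i
    using assms by (auto simp: maximal_match_def)
  obtain n where n: "pos (a + m) = pos a + n" "pos (b + m) = pos b + n" "m \<le> n"
      "\<And>i. i < n \<Longrightarrow> u (pos a + i) = u (pos b + i)"
    using match_image[of m a b] mm(4) by blast
  obtain e where e: "0 < e" "\<And>i. i < e \<Longrightarrow> u (pos (a + m) + i) = u (pos (b + m) + i)"
    "u (pos (a + m) + e) \<noteq> u (pos (b + m) + e)"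
    "(3 - L) * (S (pos (a + m) + e) - S (pos (a + m))) + w (min (u (pos (a + m) + e)) (u (pos (b + m) + e)))
       = L * w (min (u (a + m)) (u (b + m))) + 2 - L"
    using mm(2) by (rule right_image) blast
  \<comment> \<open>Both situations on the left are put in one form: for \<open>a = 0\<close>
    nothing is gained and \<open>left_weight\<close> reproduces itself, otherwise
    \<open>left_image\<close> applies to the letters before \<open>a\<close> and
    \<open>b\<close>.\<close>
  have "\<exists>s. s \<le> 1 \<and> (a = 0 \<longrightarrow> s = 0) \<and> (s = 1 \<longrightarrow> u (pos a - 1) = u (pos b - 1)) \<and>
      (a = 0 \<or> u (pos a - s - 1) \<noteq> u (pos b - s - 1)) \<and>
      (3 - L) * (S (pos a) - S (pos a - s)) + left_weight (pos a - s) (pos b - s) = L * left_weight a b - 1 \<and>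
      S (pos a) - S (pos a - s) = S (pos b) - S (pos b - s)"
  proof (cases a)
    case 0
    define c where "c = 1 / (L - 1)"
    have "c = L * c - 1" using L_gt by (simp add: c_def field_simps)
    moreover have "left_weight 0 y = c" for y by (simp add: left_weight_def c_def)
    ultimately show ?thesis by (intro exI[of _ 0]) (simp add: 0 pos_0)
  next
    case (Suc x)
    obtain y where b: "b = Suc y" using mm(1) by (cases b) auto
    have xy: "u x \<noteq> u y" using mm(3) Suc b by simp
    obtain s where s: "s \<le> 1" "s = 1 \<Longrightarrow> u (pos (Suc x) - 1) = u (pos (Suc y) - 1)"
      "u (pos (Suc x) - s - 1) \<noteq> u (pos (Suc y) - s - 1)"
      "(3 - L) * (S (pos (Suc x)) - S (pos (Suc x) - s))
         + w (min (u (pos (Suc x) - s - 1)) (u (pos (Suc y) - s - 1))) = L * w (min (u x) (u y)) - 1"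
      "S (pos (Suc x)) - S (pos (Suc x) - s) = S (pos (Suc y)) - S (pos (Suc y) - s)"
      using xy by (rule left_image) blast
    have "s < pos (Suc x)" using s(1) by (simp add: pos_Suc)
    with s show ?thesis by (intro exI[of _ s]) (simp add: Suc b left_weight_def)
  qed
  then obtain s where s: "s \<le> 1" "a = 0 \<Longrightarrow> s = 0" "s = 1 \<Longrightarrow> u (pos a - 1) = u (pos b - 1)"
      "a = 0 \<or> u (pos a - s - 1) \<noteq> u (pos b - s - 1)"
      "(3 - L) * (S (pos a) - S (pos a - s)) + left_weight (pos a - s) (pos b - s) = L * left_weight a b - 1"
      "S (pos a) - S (pos a - s) = S (pos b) - S (pos b - s)"
    by blast
  have ge: "2 * k \<le> pos k" for k using pos_add_ge[of 0 k] by simp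
  have sa: "s \<le> pos a" "0 < a \<Longrightarrow> s < pos a" using s(1,2) ge[of a] by (cases "a = 0"; simp)+
  have ab: "pos a < pos b" using mm(1) by (simp add: pos_less_iff)
  define a' b' where "a' = pos a - s" and "b' = pos b - s"
  have a': "pos a = a' + s" and b': "pos b = b' + s" using sa ab by (auto simp: a'_def b'_def)
  have shift: "a' + (s + (n + i)) = pos (a + m) + i" "b' + (s + (n + i)) = pos (b + m) + i" for i
    using n a' b' by simp_all
  have match: "u (a' + i) = u (b' + i)" if "i < s + n + e" for i
  proof -
    consider "i < s" | "s \<le> i" "i < s + n" | "s + n \<le> i" by linarith
    then show ?thesis
    proof cases
      case 1
      then have "s = 1" "i = 0" using s(1) by auto
      then show ?thesis using s(3) by (simp add: a'_def b'_def)
    next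
      case 2
      then obtain j where "i = s + j" "j < n" by (metis add_less_cancel_left le_add_diff_inverse)
      then show ?thesis using n(4)[of j] by (simp add: a' b' add.assoc)
    next
      case 3
      with that obtain j where j: "i = s + (n + j)" "j < e"
        by (metis add.assoc add_less_cancel_left le_add_diff_inverse)
      show ?thesis unfolding j(1) shift using j(2) by (rule e(2))
    qed
  qed
  have end_eq: "a' + (s + n + e) = pos (a + m) + e" "b' + (s + n + e) = pos (b + m) + e"
    using shift[of e] by (simp_all add: add.assoc)
  have "a' = 0 \<or> u (a' - 1) \<noteq> u (b' - 1)"
    using s(2,4) by (auto simp: a'_def b'_def pos_0)
  then have "maximal_match a' b' (s + n + e)"
    using e(3) a' b' ab match unfolding maximal_match_def end_eq by simp
  moreover have "excess a' b' (s + n + e) = L * excess a b m"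
  proof -
    have "S (pos (a + m)) - S (pos a) = L * (S (a + m) - S a)"
      by (simp add: S_pos algebra_simps)
    then have "(3 - L) * (S (pos (a + m)) - S (pos a)) = L * ((3 - L) * (S (a + m) - S a))"
      by simp
    then show ?thesis
      unfolding excess_def end_eq using e(4) s(5) unfolding a'_def[symmetric] b'_def[symmetric]
      by (simp add: algebra_simps)
  qed
  moreover have "S b' - S a' = L * (S b - S a)"
    using s(6) unfolding a'_def[symmetric] b'_def[symmetric] by (simp add: S_pos algebra_simps)
  moreover have "s + (pos (a + m) - pos a) < s + n + e" using n e(1) by simp
  moreover have "0 < a \<Longrightarrow> 0 < a'" using sa by (simp add: a'_def)
  ultimately show thesis using that a' b' by blast
qed

text \<open>Nonzero letters occur isolated or as \<open>(d-1)(d-1)\<close>. It follows that such a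
  match is empty or the single letter \<open>d - 1\<close>, and the period weighs at least as much
  as its first and as its last letter.\<close>

lemma excess_le_base:
  assumes mm: "maximal_match a b m" and nz: "\<And>i. i < m \<Longrightarrow> u (a + i) \<noteq> 0"
  shows "excess a b m \<le> S b - S a"
proof -
  have ab: "a < b" and ne: "u (a + m) \<noteq> u (b + m)" and left: "a = 0 \<or> u (a - 1) \<noteq> u (b - 1)"
    and eq: "\<And>i. i < m \<Longrightarrow> u (a + i) = u (b + i)"
    using mm by (auto simp: maximal_match_def)
  have first: "w (u a) \<le> S b - S a"
    using S_mono[of "Suc a" b] ab by (simp add: S_Suc)
  have last: "w (u (b - 1)) \<le> S b - S a"
    using S_mono[of a "b - 1"] ab S_Suc[of "b - 1"] by simp
  show ?thesis
  proof (cases m)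
    case 0
    have min_a: "w (min (u a) (u b)) \<le> S b - S a"
      using w_mono[of "min (u a) (u b)" "u a"] first by simp
    \<comment> \<open>The excess is now the left plus the right weight minus 1. One of the two is at
      most 1: otherwise \<open>a\<close> and \<open>b\<close> both carry a nonzero letter preceded
      by a nonzero letter, so both carry \<open>d - 1\<close>. The other is bounded by the
      period.\<close>
    show ?thesis
    proof (cases "a = 0 \<or> min (u (a - 1)) (u (b - 1)) = 0")
      case True
      then have "left_weight a b \<le> 1" using L_gt by (auto simp: left_weight_def)
      with min_a 0 show ?thesis by (simp add: excess_def)
    next
      case False
      have lw: "left_weight a b \<le> S b - S a"
        using False last w_mono[of "min (u (a - 1)) (u (b - 1))" "u (b - 1)"]
        by (simp add: left_weight_def)
      have "min (u a) (u b) = 0"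
      proof (rule ccontr)
        assume "min (u a) (u b) \<noteq> 0"
        then have "u a = d - 1" "u b = d - 1"
          using False ab nonzero_pair(2)[of "a - 1"] nonzero_pair(2)[of "b - 1"] by auto
        with ne 0 show False by simp
      qed
      with lw 0 show ?thesis by (simp add: excess_def)
    qed
  next
    case (Suc m')
    have ua: "u a \<noteq> 0" "u b = u a" using nz[of 0] eq[of 0] Suc by auto
    with u_0 have "0 < a" by (metis gr0I)
    \<comment> \<open>Since \<open>x\<close> and \<open>y\<close> differ, one of them is nonzero,
      which forces the matched letter \<open>d - 1\<close> and a 0 behind that copy; both cannot be
      nonzero, as both would be \<open>d - 1\<close>. So both minima are 0 and the excess is
      \<open>w (d - 1)\<close>.\<close>
    define x y where "x = u (a - 1)" and "y = u (b - 1)"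
    have xy: "x \<noteq> y" using left \<open>0 < a\<close> by (simp add: x_def y_def)
    have nx: "x \<noteq> 0 \<Longrightarrow> x = d - 1 \<and> u a = d - 1 \<and> u (Suc a) = 0"
      using nonzero_pair[of "a - 1"] ua \<open>0 < a\<close> by (simp add: x_def)
    have ny: "y \<noteq> 0 \<Longrightarrow> y = d - 1 \<and> u a = d - 1 \<and> u (Suc b) = 0"
      using nonzero_pair[of "b - 1"] ua ab by (simp add: y_def)
    have m': "m' = 0"
    proof (rule ccontr)
      assume "m' \<noteq> 0"
      then have "u (Suc a) \<noteq> 0" "u (Suc b) = u (Suc a)" using nz[of 1] eq[of 1] Suc by auto
      with nx ny xy show False by auto
    qed
    have "x = 0 \<or> y = 0" "u (Suc a) = 0 \<or> u (Suc b) = 0" "u a = d - 1"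
      using nx ny xy by (cases "x = 0"; cases "y = 0"; simp)+
    then have "min x y = 0" "min (u (Suc a)) (u (Suc b)) = 0" "u a = d - 1" by auto
    moreover have "(3 - L) * w (d - 1) + 1 = w (d - 1)"
      using last_eq by (simp add: algebra_simps)
    ultimately show ?thesis
      using Suc m' first \<open>0 < a\<close> by (simp add: excess_def left_weight_def x_def y_def S_Suc)
  qed
qed

text \<open>Descent on the length: both sides scale by \<open>L\<close> under
  \<open>maximal_match_image\<close>, and a match with a 0 arises in this way.\<close>

lemma excess_le: "maximal_match a b m \<Longrightarrow> excess a b m \<le> S b - S a"
proof (induction m arbitrary: a b rule: less_induct)
  case (less m)
  show ?case
  proof (cases "\<exists>i<m. u (a + i) = 0")
    case False
    with less.prems show ?thesis by (intro excess_le_base) auto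
  next
    case True
    then obtain i where i: "i < m" "u (a + i) = 0" by blast
    then have "u (b + i) = 0" using less.prems by (auto simp: maximal_match_def)
    with i obtain x y where x: "a + i = pos x" and y: "b + i = pos y" by (metis zero_imp_pos)
    have "x < y" using less.prems x y pos_less_iff[of x y] by (simp add: maximal_match_def)
    \<comment> \<open>The candidate for the preimage is the maximal match around the sources
      \<open>x\<close> and \<open>y\<close> of the two blocks. Even if \<open>x\<close> lies just
      behind it, \<open>pos x\<close> lies within the extended image, owing to the 0 gained on the
      right.\<close>
    then obtain t n where t: "t \<le> x" "t \<le> n" "maximal_match (x - t) (y - t) n"
      by (rule maximal_match_extend)
    obtain a' b' m' s where im: "maximal_match a' b' m'"
      "pos (x - t) = a' + s" "pos (y - t) = b' + s"
      "s + (pos (x - t + n) - pos (x - t)) < m'"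
      "excess a' b' m' = L * excess (x - t) (y - t) n"
      "S b' - S a' = L * (S (y - t) - S (x - t))"
      using t(3) by (rule maximal_match_image) blast
    have eq: "u (x - t + j) = u (y - t + j)" if "j < t" for j
      using t that by (auto simp: maximal_match_def)
    obtain k where k: "pos (x - t + t) = pos (x - t) + k" "pos (y - t + t) = pos (y - t) + k"
      using eq by (rule match_image) blast
    have xk: "pos x = a' + (s + k)" "pos y = b' + (s + k)"
      using k im(2,3) t(1) \<open>x < y\<close> by simp_all
    have "pos x \<le> pos (x - t + n)" using t by (simp add: pos_le_iff)
    with im(2,4) xk have sk: "s + k \<le> m'" by linarith
    have same: "a = a'" "b = b'" "m = m'"
      using maximal_match_unique[OF less.prems im(1), of i "s + k"] x y xk i sk by simp_all
    have "n < m" using im(2,4) pos_add_ge[of "x - t" n] unfolding same by linarith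
    then have "excess (x - t) (y - t) n \<le> S (y - t) - S (x - t)"
      using t(3) by (rule less.IH)
    then show ?thesis unfolding same im(5,6) using L_gt by (intro mult_left_mono) auto
  qed
qed

lemma match_weight_le:
  assumes "a < b" "\<And>i. i < m \<Longrightarrow> u (a + i) = u (b + i)"
  shows "(3 - L) * (S (a + m) - S a) \<le> S b - S a"
proof -
  obtain t n where t: "t \<le> a" "t \<le> n" "maximal_match (a - t) (b - t) n"
    using assms(1) by (rule maximal_match_extend)
  have "t + m \<le> n"
  proof (rule ccontr)
    assume "\<not> t + m \<le> n"
    with t obtain i where "n = t + i" "i < m" by (metis add_less_cancel_left le_add_diff_inverse not_le)
    then show False using t assms(1) assms(2)[of i] by (simp add: maximal_match_def)
  qed
  have eq: "u (a - t + j) = u (b - t + j)" if "j < t" for j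
    using t that by (auto simp: maximal_match_def)
  \<comment> \<open>Moving both starts across matched letters leaves the weight between them
    unchanged.\<close>
  have shift: "S (b - t + j) - S (a - t + j) = S (b - t) - S (a - t)" if "j \<le> t" for j
    using that by (induction j) (simp_all add: S_Suc eq)
  have "S (a + m) \<le> S (a - t + n)"
    using t(1) \<open>t + m \<le> n\<close> by (intro S_mono) simp
  then have "(3 - L) * (S (a + m) - S a) \<le> (3 - L) * (S (a - t + n) - S (a - t))"
    using S_mono[of "a - t" a] L_less by (intro mult_left_mono) auto
  also have "\<dots> \<le> excess (a - t) (b - t) n"
    using left_weight_nonneg[of "a - t" "b - t"] w_ge_1[of "min (u (a - t + n)) (u (b - t + n))"]
    by (simp add: excess_def)
  also have "\<dots> \<le> S (b - t) - S (a - t)" using t(3) by (rule excess_le)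
  also have "\<dots> = S b - S a" using shift[of t] t(1) assms(1) by simp
  finally show ?thesis .
qed

section \<open>Length against weight\<close>

lemma iter_pos: "(pos ^^ n) k = (\<Sum>i<k. iter_length d n (u i))"
proof (induction n arbitrary: k)
  case (Suc n)
  have "(pos ^^ Suc n) k = (pos ^^ n) (pos k)" by (simp add: funpow_swap1)
  also have "\<dots> = (\<Sum>i<pos k. iter_length d n (u i))" by (rule Suc)
  finally show ?case by (simp add: sum_block)
qed simp

lemma S_iter_pos: "S ((pos ^^ n) k) = L ^ n * S k"
  by (induction n) (simp_all add: S_pos)

text \<open>\<open>|phi^(n+1)(j)| / (L^(n+1) * w j)\<close> is a weighted mean of the ratios for \<open>n\<close> in which the
  letter \<open>0\<close> has weight at least \<open>1 / (L * w (d - 1))\<close>, so the spread contracts.\<close>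

lemma iter_length_bounds:
  "\<exists>lo hi. 1 / w (d - 1) \<le> lo \<and> lo \<le> hi \<and> hi - lo \<le> (1 - 1 / (L * w (d - 1))) ^ n \<and>
     (\<forall>j<d. lo * L ^ n * w j \<le> iter_length d n j \<and> iter_length d n j \<le> hi * L ^ n * w j)"
proof (induction n)
  case 0
  have "1 / w (d - 1) * w j \<le> 1" "1 \<le> w j" if "j < d" for j
    using w_mono[of j "d - 1"] that w_ge_1[of "d - 1"] w_ge_1[of j] by (auto simp: field_simps)
  then show ?case using w_ge_1[of "d - 1"]
    by (intro exI[of _ "1 / w (d - 1)"] exI[of _ 1]) (auto simp: field_simps)
next
  case (Suc n)
  define \<delta> where "\<delta> = 1 / (L * w (d - 1))"
  define P where "P = L ^ n"
  have P: "0 < P" using L_gt by (simp add: P_def)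
  obtain lo hi where lh: "1 / w (d - 1) \<le> lo" "lo \<le> hi" "hi - lo \<le> (1 - \<delta>) ^ n"
    "\<And>j. j < d \<Longrightarrow> lo * P * w j \<le> iter_length d n j"
    "\<And>j. j < d \<Longrightarrow> iter_length d n j \<le> hi * P * w j"
    using Suc unfolding \<delta>_def P_def by blast
  \<comment> \<open>Every image contains 0 exactly once, so the ratio \<open>r\<close> of the letter
    0 enters the new ratio of every letter; the rest of the image has weight
    \<open>L * w j - 1\<close>.\<close>
  define r where "r = iter_length d n 0 / P"
  have hr: "real (iter_length d n 0) = r * P" using P by (simp add: r_def)
  have r: "lo \<le> r" "r \<le> hi"
    using lh(4)[of 0] lh(5)[of 0] d_ge P unfolding hr by simp_all
  have W: "1 \<le> w (d - 1)" by (rule w_ge_1)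
  have \<delta>: "0 < \<delta>" "\<delta> < 1"
  proof -
    have "1 * 1 < L * w (d - 1)" using W L_gt by (intro mult_less_le_imp_less) auto
    then show "0 < \<delta>" "\<delta> < 1" by (auto simp: \<delta>_def)
  qed
  have \<delta>w: "\<delta> * (L * w j) \<le> 1" if "j < d" for j
  proof -
    have "\<delta> * (L * w j) = w j / w (d - 1)" using L_gt by (simp add: \<delta>_def)
    then show ?thesis using w_mono[of j "d - 1"] that W by simp
  qed
  have rest: "lo * P * (L * w j - 1) + r * P \<le> iter_length d (Suc n) j \<and>
      iter_length d (Suc n) j \<le> hi * P * (L * w j - 1) + r * P" if "j < d" for j
  proof (cases "j = d - 1")
    case True
    then have "real (iter_length d (Suc n) j) = r * P + 2 * real (iter_length d n (d - 1))"
      using hr d_ge by (simp add: phi_def)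
    moreover have "L * w j - 1 = 2 * w (d - 1)" using last_eq True by simp
    moreover have "d - 1 < d" using d_ge by simp
    ultimately show ?thesis using lh(4)[of "d - 1"] lh(5)[of "d - 1"] by simp
  next
    case False
    then have "Suc j < d" using that by simp
    then show ?thesis using lh(4)[of "Suc j"] lh(5)[of "Suc j"] hr by (simp add: phi_def)
  qed
  have lo': "(lo + \<delta> * (r - lo)) * (P * (L * w j)) \<le> lo * P * (L * w j - 1) + r * P" if "j < d" for j
  proof -
    have "(r - lo) * P * (\<delta> * (L * w j)) \<le> (r - lo) * P * 1"
      using r P \<delta>w[OF that] by (intro mult_left_mono) auto
    then show ?thesis by (simp add: algebra_simps)
  qed
  have hi': "hi * P * (L * w j - 1) + r * P \<le> (hi - \<delta> * (hi - r)) * (P * (L * w j))" if "j < d" for j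
  proof -
    have "(hi - r) * P * (\<delta> * (L * w j)) \<le> (hi - r) * P * 1"
      using r P \<delta>w[OF that] by (intro mult_left_mono) auto
    then show ?thesis by (simp add: algebra_simps)
  qed
  have "(lo + \<delta> * (r - lo)) * L ^ Suc n * w j \<le> iter_length d (Suc n) j \<and>
      iter_length d (Suc n) j \<le> (hi - \<delta> * (hi - r)) * L ^ Suc n * w j" if "j < d" for j
  proof -
    have eq: "z * L ^ Suc n * w j = z * (P * (L * w j))" for z by (simp add: P_def)
    show ?thesis unfolding eq
      using order_trans[OF lo'[OF that] conjunct1[OF rest[OF that]]]
        order_trans[OF conjunct2[OF rest[OF that]] hi'[OF that]] by (rule conjI)
  qed
  moreover have "hi - \<delta> * (hi - r) - (lo + \<delta> * (r - lo)) = (1 - \<delta>) * (hi - lo)"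
    by (simp add: algebra_simps)
  moreover from this have "lo + \<delta> * (r - lo) \<le> hi - \<delta> * (hi - r)"
    using \<delta> lh(2) mult_nonneg_nonneg[of "1 - \<delta>" "hi - lo"] by linarith
  moreover have "(1 - \<delta>) * (hi - lo) \<le> (1 - \<delta>) ^ Suc n"
    using \<delta> lh(3) by (simp add: mult_left_mono)
  moreover have "1 / w (d - 1) \<le> lo + \<delta> * (r - lo)"
    using lh(1) \<delta> r by (simp add: add_increasing2)
  ultimately show ?case
    unfolding \<delta>_def[symmetric]
    by (intro exI[of _ "lo + \<delta> * (r - lo)"] exI[of _ "hi - \<delta> * (hi - r)"]) auto
qed

text \<open>Windows are rounded to blocks of \<open>phi^n\<close>, with \<open>n\<close> so large
  that the ratio of length to weight is nearly the same for all letters; \<open>K\<close> pays for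
  the rounding. The constant \<open>c\<close> may depend on \<epsilon>, as it cancels when a match
  is compared with its period.\<close>

lemma length_weight_ratio:
  assumes "0 < \<epsilon>"
  obtains c K where "0 < c" "0 \<le> K"
    "\<And>x y. x \<le> y \<Longrightarrow> c * (S y - S x) \<le> real (y - x) + K"
    "\<And>x y. x \<le> y \<Longrightarrow> real (y - x) \<le> (1 + \<epsilon>) * c * (S y - S x) + K"
proof -
  define W where "W = w (d - 1)"
  have W: "1 \<le> W" unfolding W_def by (rule w_ge_1)
  have "1 * 1 < L * W" using W L_gt by (intro mult_less_le_imp_less) auto
  then have "1 - 1 / (L * W) < 1" by simp
  \<comment> \<open>Since \<open>lo\<close> is at least \<open>1 / W\<close>, a spread below
    \<open>\<epsilon> / W\<close> gives \<open>hi \<le> (1 + \<epsilon>) * lo\<close>.\<close>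
  then obtain n where n: "(1 - 1 / (L * W)) ^ n < \<epsilon> / W"
    using real_arch_pow_inv[of "\<epsilon> / W" "1 - 1 / (L * W)"] W assms by auto
  obtain lo hi where lh: "1 / W \<le> lo" "lo \<le> hi" "hi - lo \<le> (1 - 1 / (L * W)) ^ n"
    and h: "\<And>j. j < d \<Longrightarrow> lo * L ^ n * w j \<le> iter_length d n j"
    "\<And>j. j < d \<Longrightarrow> iter_length d n j \<le> hi * L ^ n * w j"
    using iter_length_bounds[of n] unfolding W_def by blast
  have lo: "0 < lo" using lh(1) W by (smt (verit) divide_pos_pos)
  have "hi \<le> lo + \<epsilon> * (1 / W)" using n lh(3) by simp
  also have "\<dots> \<le> lo + \<epsilon> * lo" using lh(1) assms by (intro add_left_mono mult_left_mono) auto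
  finally have hi: "hi \<le> (1 + \<epsilon>) * lo" by (simp add: algebra_simps)
  define P where "P = pos ^^ n"
  have P_Suc: "P (Suc k) = P k + iter_length d n (u k)" for k
    by (simp add: P_def iter_pos)
  have S_P: "S (P k) = L ^ n * S k" for k
    by (simp add: P_def S_iter_pos)
  have "strict_mono P" unfolding P_def
    by (induction n) (auto intro: strict_mono_pos strict_mono_compose strict_monoI)
  define K where "K = hi * L ^ n * W"
  have hi_pos: "0 < hi" using lo lh(2) by simp
  have K: "0 \<le> K" unfolding K_def using hi_pos L_gt W by simp
  have gap: "real (iter_length d n (u k)) \<le> K" for k
  proof -
    have "hi * L ^ n * w (u k) \<le> K" unfolding K_def W_def
      using hi_pos L_gt w_le_last by (intro mult_left_mono) auto
    then show ?thesis using h(2)[OF u_less[of k]] by linarith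
  qed
  have grid: "lo * (S (P k') - S (P k)) \<le> real (P k') - real (P k) \<and>
      real (P k') - real (P k) \<le> hi * (S (P k') - S (P k))" if "k \<le> k'" for k k'
    using that
  proof (induction k' rule: dec_induct)
    case (step k')
    have "S (P (Suc k')) = S (P k') + L ^ n * w (u k')"
      unfolding S_P S_Suc by (simp add: algebra_simps)
    moreover have "real (P (Suc k')) = real (P k') + real (iter_length d n (u k'))"
      by (simp add: P_Suc)
    ultimately show ?case using step h[OF u_less[of k']] by (simp add: algebra_simps)
  qed simp
  have round: "\<exists>k. P k \<le> x \<and> x < P (Suc k)" for x
  proof -
    have "P 0 \<le> x" by (simp add: P_def iter_pos)
    with \<open>strict_mono P\<close> obtain k where "P k \<le> x" "x < P (Suc k)"
      by (rule strict_mono_between)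
    then show ?thesis by blast
  qed
  have "c * (S y - S x) \<le> real (y - x) + (K + hi * W * K) \<and>
      real (y - x) \<le> (1 + \<epsilon>) * c * (S y - S x) + (K + hi * W * K)"
    if xy: "x \<le> y" and c: "c = lo" for x y c
  proof -
    obtain k where k: "P k \<le> x" "x < P (Suc k)" using round by blast
    obtain l where l: "P l \<le> y" "y < P (Suc l)" using round by blast
    have "P k < P (Suc l)" using k(1) l(2) xy by linarith
    then have "k \<le> l" using \<open>strict_mono P\<close> by (simp add: strict_mono_less)
    note g = grid[OF this]
    have xk: "real x - real (P k) \<le> K" and yl: "real y - real (P l) \<le> K"
      using k l gap[of k] gap[of l] by (simp_all add: P_Suc)
    \<comment> \<open>Rounding down to a block boundary costs at most \<open>K\<close> in length,
      hence at most \<open>W * K\<close> in weight.\<close>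
    have "S z - S (P j) \<le> W * K" if "P j \<le> z" "real z - real (P j) \<le> K" for z j
    proof -
      have "S z - S (P j) \<le> W * real (z - P j)" unfolding W_def using that(1) by (rule S_diff_bounds)
      also have "\<dots> \<le> W * K" using that W by (intro mult_left_mono) auto
      finally show ?thesis .
    qed
    note near = this[OF k(1) xk] this[OF l(1) yl]
    have "lo * (S y - S x) \<le> lo * (S (P l) - S (P k) + W * K)"
      using near S_mono[OF k(1)] lo by (intro mult_left_mono) auto
    also have "\<dots> = lo * (S (P l) - S (P k)) + lo * (W * K)" by (simp add: algebra_simps)
    also have "\<dots> \<le> (real y - real (P k)) + hi * (W * K)"
      using g l(1) lh(2) W K by (intro add_mono mult_right_mono) auto
    finally have 1: "lo * (S y - S x) \<le> real (y - x) + (K + hi * W * K)"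
      using xk xy by (simp add: mult.assoc of_nat_diff)
    have "real (y - x) \<le> real (P l) - real (P k) + K" using xy k(1) yl by (simp add: of_nat_diff)
    also have "\<dots> \<le> hi * (S (P l) - S (P k)) + K" using g by simp
    also have "\<dots> \<le> hi * (S y - S x + W * K) + K"
      using near S_mono[OF l(1)] hi_pos by (intro add_right_mono mult_left_mono) auto
    also have "\<dots> = hi * (S y - S x) + (K + hi * W * K)" by (simp add: algebra_simps)
    also have "\<dots> \<le> (1 + \<epsilon>) * lo * (S y - S x) + (K + hi * W * K)"
      using hi S_mono[OF xy] by (intro add_right_mono mult_right_mono) auto
    finally show ?thesis using 1 by (simp add: c)
  qed
  moreover have "0 \<le> K + hi * W * K" using K hi_pos W by simp
  ultimately show thesis using lo by (intro that[of lo "K + hi * W * K"]) auto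
qed

section \<open>Upper and lower bounds for match lengths\<close>

lemma match_length_le:
  assumes "0 < \<epsilon>"
  obtains K where "0 \<le> K"
    "\<And>a b m. a < b \<Longrightarrow> (\<And>i. i < m \<Longrightarrow> u (a + i) = u (b + i)) \<Longrightarrow>
       real m \<le> (1 + \<epsilon>) / (3 - L) * real (b - a) + K"
proof -
  obtain c K where c: "0 < c" "0 \<le> K"
    "\<And>x y. x \<le> y \<Longrightarrow> c * (S y - S x) \<le> real (y - x) + K"
    "\<And>x y. x \<le> y \<Longrightarrow> real (y - x) \<le> (1 + \<epsilon>) * c * (S y - S x) + K"
    using assms by (rule length_weight_ratio) blast
  define q where "q = (1 + \<epsilon>) / (3 - L)"
  have q: "0 \<le> q" using assms L_less by (simp add: q_def)
  have bound: "real m \<le> q * real (b - a) + (q * K + K)"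
    if ab: "a < b" and match: "\<And>i. i < m \<Longrightarrow> u (a + i) = u (b + i)" for a b m
  proof -
    \<comment> \<open>From length to weight for the match and back to length for the period, which
      eliminates \<open>c\<close>.\<close>
    have "real m \<le> (1 + \<epsilon>) * c * (S (a + m) - S a) + K" using c(4)[of a "a + m"] by simp
    also have "(1 + \<epsilon>) * c * (S (a + m) - S a) = q * (c * ((3 - L) * (S (a + m) - S a)))"
      using L_less by (simp add: q_def)
    also have "\<dots> \<le> q * (c * (S b - S a))"
      using match_weight_le[OF ab match] c(1) q by (intro mult_left_mono) auto
    also have "\<dots> \<le> q * (real (b - a) + K)" using c(3)[of a b] ab q by (intro mult_left_mono) auto
    finally show ?thesis by (simp add: algebra_simps)
  qed
  show thesis
  proof (rule that)
    show "0 \<le> q * K + K" using q c(2) by simp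
  qed (unfold q_def[symmetric], rule bound)
qed

text \<open>The seed is the empty match between positions 2 and 3: the word starts with
  \<open>0 1 0\<close> and a nonzero letter, so the period is a single 0 and both neighbouring
  minima are 0. Taking images preserves the equality.\<close>

lemma extremal_matches:
  "\<exists>a b m. maximal_match a b m \<and> 0 < a \<and> S b - S a = L ^ k \<and> excess a b m = L ^ k"
proof (induction k)
  case 0
  have pos_1: "pos 1 = 2" using pos_Suc[of 0] u_0 d_ge by (simp add: pos_0)
  have u: "u 1 = 1" "u 2 = 0" "u 3 \<noteq> 0"
    using u_pos_1[of 0] u_pos[of 1] u_pos_1[of 1] u_0 d_ge pos_1
    by (auto simp: pos_0 numeral_eq_Suc split: if_splits)
  have "maximal_match 2 3 0" using u by (simp add: maximal_match_def)
  moreover have "S 3 - S 2 = 1" using S_Suc[of 2] u by simp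
  moreover have "excess 2 3 0 = 1" using u by (simp add: excess_def left_weight_def)
  ultimately show ?case by (intro exI[of _ 2] exI[of _ 3] exI[of _ 0]) simp
next
  case (Suc k)
  then obtain a b m where m: "maximal_match a b m" "0 < a" "S b - S a = L ^ k" "excess a b m = L ^ k"
    by blast
  obtain a' b' m' where "maximal_match a' b' m'" "excess a' b' m' = L * excess a b m"
      "S b' - S a' = L * (S b - S a)" "0 < a'"
    using m(1) by (rule maximal_match_image) (use m(2) in blast)
  with m show ?case by (intro exI[of _ a'] exI[of _ b'] exI[of _ m']) simp
qed

text \<open>For extremal matches the weight of the period equals the excess, which exceeds
  \<open>3 - L\<close> times the weight of the match by at most a constant.\<close>

lemma long_matches:
  assumes "0 < \<epsilon>" "\<epsilon> < 1"
  obtains K where "0 \<le> K"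
    "\<And>N. \<exists>a b m. a < b \<and> N \<le> b - a \<and> (\<forall>i<m. u (a + i) = u (b + i)) \<and>
       (1 - \<epsilon>) * real (b - a) \<le> (3 - L) * real m + K"
proof -
  define W where "W = w (d - 1)"
  have W: "1 \<le> W" unfolding W_def by (rule w_ge_1)
  obtain c K where c: "0 < c" "0 \<le> K"
    "\<And>x y. x \<le> y \<Longrightarrow> c * (S y - S x) \<le> real (y - x) + K"
    "\<And>x y. x \<le> y \<Longrightarrow> real (y - x) \<le> (1 + \<epsilon>) * c * (S y - S x) + K"
    using assms(1) by (rule length_weight_ratio) blast
  define C where "C = (3 - L) * K + c * (2 * W) + K"
  have "\<exists>a b m. a < b \<and> N \<le> b - a \<and> (\<forall>i<m. u (a + i) = u (b + i)) \<and>
       (1 - \<epsilon>) * real (b - a) \<le> (3 - L) * real m + C" for N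
  proof -
    \<comment> \<open>No letter weighs more than \<open>W\<close>, so a weight above
      \<open>W * N\<close> forces a length above \<open>N\<close>.\<close>
    obtain k where k: "W * real N < L ^ k" using real_arch_pow[of L "W * real N"] L_gt by auto
    obtain a b m where m: "maximal_match a b m" "0 < a" "S b - S a = L ^ k" "excess a b m = L ^ k"
      using extremal_matches[of k] by blast
    then have ab: "a < b" and match: "\<forall>i<m. u (a + i) = u (b + i)"
      by (auto simp: maximal_match_def)
    have "W * real N < W * real (b - a)"
      using k m(3) S_diff_bounds(2)[of a b] ab unfolding W_def by simp
    then have N: "N \<le> b - a" using W by simp
    have "left_weight a b \<le> W" "w (min (u (a + m)) (u (b + m))) \<le> W"
      using m(2) w_mono[of "min (u (a - 1)) (u (b - 1))" "u (a - 1)"] w_le_last[of "a - 1"]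
        w_mono[of "min (u (a + m)) (u (b + m))" "u (a + m)"] w_le_last[of "a + m"]
      unfolding W_def by (auto simp: left_weight_def)
    then have "S b - S a \<le> (3 - L) * (S (a + m) - S a) + 2 * W"
      using m(3,4) by (simp add: excess_def)
    then have "c * (S b - S a) \<le> c * ((3 - L) * (S (a + m) - S a) + 2 * W)"
      using c(1) by (intro mult_left_mono) auto
    also have "\<dots> = (3 - L) * (c * (S (a + m) - S a)) + c * (2 * W)" by (simp add: algebra_simps)
    also have "\<dots> \<le> (3 - L) * (real m + K) + c * (2 * W)"
      using c(3)[of a "a + m"] L_less by (intro add_right_mono mult_left_mono) auto
    finally have 1: "c * (S b - S a) \<le> (3 - L) * real m + (3 - L) * K + c * (2 * W)"
      by (simp add: algebra_simps)
    define X where "X = (3 - L) * real m + C"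
    have "real (b - a) \<le> (1 + \<epsilon>) * (c * (S b - S a)) + K" using c(4)[of a b] ab by simp
    also have "\<dots> \<le> (1 + \<epsilon>) * (c * (S b - S a)) + (1 + \<epsilon>) * K"
      using assms(1) c(2) by (simp add: algebra_simps)
    also have "\<dots> = (1 + \<epsilon>) * (c * (S b - S a) + K)" by (simp add: algebra_simps)
    also have "\<dots> \<le> (1 + \<epsilon>) * X"
      using 1 assms(1) unfolding X_def C_def by (intro mult_left_mono) auto
    \<comment> \<open>Multiplying by \<open>1 - \<epsilon>\<close> moves the factor
      \<open>1 + \<epsilon>\<close> to the other side, their product being below 1.\<close>
    finally have "(1 - \<epsilon>) * real (b - a) \<le> (1 - \<epsilon>) * ((1 + \<epsilon>) * X)"
      using assms(2) by (intro mult_left_mono) auto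
    also have "\<dots> = X - \<epsilon>\<^sup>2 * X" by (simp add: algebra_simps power2_eq_square)
    also have "\<dots> \<le> X"
      unfolding X_def C_def using L_less c W by simp
    finally show ?thesis using ab N match unfolding X_def by blast
  qed
  moreover have "0 \<le> C" unfolding C_def using L_less c W by simp
  ultimately show thesis by (intro that[of C]) auto
qed

section \<open>The spectral radius of the incidence matrix\<close>

lemma set_phi: "j < d \<Longrightarrow> set (phi d j) \<subseteq> {..<d}"
  by (auto simp: phi_def split: if_splits)

lemma weight_incidence:
  assumes "j < d"
  shows "(\<Sum>i<d. real (count_list (phi d j) i) * w i) = L * w j"
proof -
  have *: "set xs \<subseteq> {..<d} \<Longrightarrow> sum_list (map w xs) = (\<Sum>i<d. real (count_list xs i) * w i)" for xs
  proof (induction xs)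
    case (Cons x xs)
    have "(\<Sum>i<d. real (count_list (x # xs) i) * w i)
        = (\<Sum>i<d. (if i = x then w i else 0) + real (count_list xs i) * w i)"
      by (intro sum.cong) (auto simp: algebra_simps)
    also have "\<dots> = w x + (\<Sum>i<d. real (count_list xs i) * w i)"
      using Cons.prems by (simp add: sum.distrib)
    finally show ?case using Cons by simp
  qed simp
  show ?thesis using *[OF set_phi[OF assms]] w_block[OF assms] by simp
qed

text \<open>The weights form a left eigenvector, so \<open>L\<close> is an eigenvalue of the
  transpose and hence of the matrix. Conversely, pairing the absolute values of an eigenvector for
  \<mu> with the positive weights bounds \<open>norm \<mu>\<close> by \<open>L\<close>.\<close>

lemma spectral_radius_incidence: "spectral_radius (incidence_matrix d (phi d)) = L"
proof -
  define A where "A = incidence_matrix d (phi d)"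
  have A: "A \<in> carrier_mat d d" by (simp add: A_def incidence_matrix_def)
  have A_nth: "A $$ (i, j) = of_real (real (count_list (phi d j) i))" if "i < d" "j < d" for i j
    using that by (simp add: A_def incidence_matrix_def)
  have d: "0 < d" using d_ge by simp
  define v :: "complex vec" where "v = vec d (\<lambda>i. of_real (w i))"
  have "eigenvector (transpose_mat A) v (of_real L)"
    unfolding eigenvector_def
  proof (intro conjI)
    show "v \<in> carrier_vec (dim_row (transpose_mat A))" using A by (simp add: v_def)
    have "v $ 0 = 1" using d by (simp add: v_def)
    then show "v \<noteq> 0\<^sub>v (dim_row (transpose_mat A))" using A d by auto
    show "transpose_mat A *\<^sub>v v = of_real L \<cdot>\<^sub>v v"
    proof (rule eq_vecI)
      fix j assume "j < dim_vec (of_real L \<cdot>\<^sub>v v)"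
      then have j: "j < d" by (simp add: v_def)
      have "(transpose_mat A *\<^sub>v v) $ j = (\<Sum>i<d. A $$ (i, j) * of_real (w i))"
        using A j by (simp add: v_def scalar_prod_def lessThan_atLeast0)
      also have "\<dots> = of_real (\<Sum>i<d. real (count_list (phi d j) i) * w i)"
        using j by (simp add: A_nth)
      also have "\<dots> = (of_real L \<cdot>\<^sub>v v) $ j"
        using j unfolding weight_incidence[OF j] by (simp add: v_def)
      finally show "(transpose_mat A *\<^sub>v v) $ j = (of_real L \<cdot>\<^sub>v v) $ j" .
    qed (use A in \<open>simp add: v_def\<close>)
  qed
  then have "eigenvalue (transpose_mat A) (of_real L)" by (auto simp: eigenvalue_def)
  then have "of_real L \<in> spectrum A"
    using A eigenvalue_root_char_poly[of "transpose_mat A" d] by (simp add: spectrum_root_char_poly)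
  then have "L \<in> norm ` spectrum A" using L_gt by (force simp: image_iff intro: bexI[of _ "of_real L"])
  then have ge: "L \<le> spectral_radius A" by (rule spectral_radius_mem_max(2)[OF A d])
  obtain \<mu> where \<mu>: "\<mu> \<in> spectrum A" "norm \<mu> = spectral_radius A"
    using spectral_radius_mem_max(1)[OF A d] by auto
  then obtain x where x: "x \<in> carrier_vec d" "x \<noteq> 0\<^sub>v d" "A *\<^sub>v x = \<mu> \<cdot>\<^sub>v x"
    using A by (auto simp: spectrum_def eigenvalue_def eigenvector_def)
  have comp: "\<mu> * x $ i = (\<Sum>j<d. A $$ (i, j) * x $ j)" if "i < d" for i
  proof -
    have "(A *\<^sub>v x) $ i = (\<Sum>j<d. A $$ (i, j) * x $ j)"
      using A x(1) that by (auto simp: scalar_prod_def lessThan_atLeast0 intro!: sum.cong)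
    then show ?thesis using x(1,3) that by simp
  qed
  define T where "T = (\<Sum>j<d. w j * norm (x $ j))"
  obtain k where k: "k < d" "x $ k \<noteq> 0"
    using x(1,2) by (metis carrier_vecD eq_vecI index_zero_vec)
  have w_pos: "0 < w j" for j using w_ge_1[of j] by simp
  have "0 < w k * norm (x $ k)" using k w_pos by simp
  also have "\<dots> \<le> T" unfolding T_def
    using k less_imp_le[OF w_pos] by (intro member_le_sum) (auto intro!: mult_nonneg_nonneg)
  finally have T: "0 < T" .
  have "norm \<mu> * T = (\<Sum>i<d. w i * norm (\<mu> * x $ i))"
    by (simp add: T_def sum_distrib_left norm_mult mult_ac)
  also have "\<dots> \<le> (\<Sum>i<d. w i * (\<Sum>j<d. real (count_list (phi d j) i) * norm (x $ j)))"
  proof (intro sum_mono mult_left_mono)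
    fix i assume "i \<in> {..<d}"
    then have i: "i < d" by simp
    show "norm (\<mu> * x $ i) \<le> (\<Sum>j<d. real (count_list (phi d j) i) * norm (x $ j))"
      unfolding comp[OF i]
      by (rule order_trans[OF norm_sum]) (intro sum_mono, simp add: A_nth[OF i] norm_mult)
  qed (use w_pos in \<open>auto intro: less_imp_le\<close>)
  also have "\<dots> = (\<Sum>j<d. (\<Sum>i<d. real (count_list (phi d j) i) * w i) * norm (x $ j))"
    unfolding sum_distrib_left sum_distrib_right by (subst sum.swap) (simp add: mult_ac)
  also have "\<dots> = L * T"
    unfolding T_def sum_distrib_left by (intro sum.cong) (simp_all add: weight_incidence)
  finally have "norm \<mu> \<le> L" using T by simp
  with ge \<mu> show ?thesis unfolding A_def by simp
qed

end

text \<open>Intermediate values between 2 and 3: the left side is 0 at 2 and above 1 at 3, which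
  also excludes both end points.\<close>

lemma weight_root_exists:
  assumes "3 \<le> d"
  obtains L where "2 < L" "L < 3" "(L - 2) * weight L (d - 1) = 1"
proof -
  have cont: "isCont (\<lambda>L. weight L n) x" for n x
    by (induction n) (auto intro!: continuous_intros)
  have "real n + 1 \<le> weight 3 n" for n by (induction n) auto
  from this[of "d - 1"] have f3: "1 < weight 3 (d - 1)" using assms by simp
  then have "\<exists>L\<ge>2. L \<le> 3 \<and> (L - 2) * weight L (d - 1) = 1"
    by (intro IVT) (auto intro!: continuous_intros cont)
  then obtain L where L: "2 \<le> L" "L \<le> 3" "(L - 2) * weight L (d - 1) = 1" by blast
  moreover have "L \<noteq> 2" "L \<noteq> 3" using L(3) f3 by auto
  ultimately show thesis by (intro that[of L]) auto
qed

text \<open>The word equals its own image, so cutting it after \<open>k\<close> letters exhibits the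
  block of the next letter right behind the image of that prefix.\<close>

lemma fixed_word_phi_fixed_point:
  assumes "3 \<le> d"
  shows "phi_fixed_point d (snth (fixed_word d))"
proof -
  define s where "s = fixed_word d"
  have "s \<in> streams {..<d} \<and> shd s = 0 \<and> flat (smap (phi d) s) = s"
    unfolding s_def fixed_word_def by (rule theI'[OF fixed_word_ex1]) (use assms in simp)
  then have s: "s \<in> streams {..<d}" "shd s = 0" "flat (smap (phi d) s) = s" by auto
  have block: "s !! (block_start d (snth s) k + i) = phi d (s !! k) ! i"
    if "i < length (phi d (s !! k))" for i k
  proof -
    let ?v = "concat (map (phi d) (stake k s))"
    have len: "length ?v = block_start d (snth s) k"
      by (simp add: block_start_def length_concat sum_list_sum_nth lessThan_atLeast0)
    have "sdrop k s = s !! k ## sdrop (Suc k) s" by (rule stream.collapse[of "sdrop k s", unfolded sdrop_simps, symmetric])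
    then have drop: "flat (smap (phi d) (sdrop k s)) = phi d (s !! k) @- flat (smap (phi d) (sdrop (Suc k) s))"
      by (simp add: phi_def)
    have "s = flat (smap (phi d) (stake k s @- sdrop k s))" using s(3) by (simp add: stake_sdrop)
    also have "\<dots> = ?v @- (phi d (s !! k) @- flat (smap (phi d) (sdrop (Suc k) s)))"
      unfolding flat_smap_phi_shift drop ..
    finally have "s !! (length ?v + i) = (phi d (s !! k) @- flat (smap (phi d) (sdrop (Suc k) s))) !! i"
      by (metis add_diff_cancel_left' le_add1 shift_snth_ge)
    with that show ?thesis unfolding len by simp
  qed
  show ?thesis unfolding s_def[symmetric]
    using assms s block by unfold_locales (auto simp: streams_iff_snth)
qed

section \<open>Fractional powers and matches\<close>

lemma snth_cycle:
  assumes "v \<noteq> []"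
  shows "cycle v !! i = v ! (i mod length v)"
proof -
  have "cycle v !! i = shd (cycle (rotate (i mod length v) v))"
    using assms by (simp add: sdrop_simps(1)[symmetric] sdrop_cycle)
  also have "\<dots> = v ! (i mod length v)"
    using assms by (simp add: hd_rotate_conv_nth)
  finally show ?thesis .
qed

text \<open>A power of length \<open>N\<close> and period \<open>p\<close> is a match of length
  \<open>N - p\<close> at distance \<open>p\<close>. The bound on \<open>e\<close> is an inequality
  because \<open>N - p\<close> is cut off at 0 if \<open>N < p\<close>.\<close>

lemma factor_exponentE:
  assumes "e \<in> factor_exponents n s"
  obtains a p m where "0 < p" "n \<le> p" "of_rat e \<le> 1 + real m / real p"
    "\<And>i. i < m \<Longrightarrow> s !! (a + i) = s !! (a + p + i)"
proof -
  obtain v N where v: "v \<noteq> []" "n \<le> length v" "e * of_nat (length v) = of_nat N"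
      and fac: "is_factor (frac_power v e) s"
    using assms by (auto simp: factor_exponents_def elim!: Nats_cases)
  obtain a where a: "stake N (sdrop a s) = stake N (cycle v)"
    using fac v(3) by (auto simp: is_factor_def frac_power_def)
  define p where "p = length v"
  have nth: "s !! (a + i) = v ! (i mod p)" if "i < N" for i
    using arg_cong[OF a, of "\<lambda>xs. xs ! i"] that by (simp add: snth_cycle[OF v(1)] sdrop_snth p_def add.commute)
  have p: "0 < p" using v(1) by (simp add: p_def)
  have "e = of_nat N / of_nat p" using v(3) p by (simp add: p_def field_simps)
  then have "of_rat e = real N / real p" by (simp add: of_rat_divide)
  also have "\<dots> \<le> 1 + real (N - p) / real p"
    using p by (simp add: field_simps)
  finally have "of_rat e \<le> 1 + real (N - p) / real p" .
  moreover have "s !! (a + i) = s !! (a + p + i)" if "i < N - p" for i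
    using nth[of i] nth[of "p + i"] that by (simp add: add.assoc)
  ultimately show thesis using that p v(2) unfolding p_def by blast
qed

text \<open>The match makes the window of \<open>m + p\<close> letters periodic, so it is a power of
  its first \<open>p\<close> letters.\<close>

lemma factor_exponentI:
  assumes p: "0 < p" "n \<le> p" and match: "\<And>i. i < m \<Longrightarrow> s !! (a + i) = s !! (a + p + i)"
  shows "1 + of_nat m / of_nat p \<in> factor_exponents n s"
proof -
  define v where "v = stake p (sdrop a s)"
  have v: "v \<noteq> []" "length v = p" using p(1) by (auto simp: v_def)
  have "s !! (a + i) = s !! (a + i mod p)" if "i < m + p" for i
    using that
  proof (induction i rule: less_induct)
    case (less i)
    show ?case
    proof (cases "i < p")
      case False
      then have "s !! (a + i) = s !! (a + (i - p))"
        using match[of "i - p"] less.prems by (simp add: add.assoc)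
      also have "\<dots> = s !! (a + (i - p) mod p)"
        using less.prems False p by (intro less.IH) auto
      finally show ?thesis using False by (simp add: le_mod_geq)
    qed simp
  qed
  then have eq: "stake (m + p) (sdrop a s) = stake (m + p) (cycle v)"
    using p(1) by (intro nth_equalityI)
      (auto simp: snth_cycle[OF v(1)] v(2) sdrop_snth add.commute, simp add: v_def sdrop_snth add.commute)
  define e :: rat where "e = 1 + of_nat m / of_nat p"
  have e: "e * of_nat p = of_nat (m + p)" using p(1) by (simp add: e_def field_simps)
  have "frac_power v e = stake (m + p) (cycle v)"
    unfolding frac_power_def v(2) e by (simp only: floor_of_nat nat_int)
  then have "is_factor (frac_power v e) s"
    unfolding is_factor_def using eq by (intro exI[of _ a]) simp
  moreover have "0 < e" by (simp add: e_def add_pos_nonneg)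
  ultimately show ?thesis
    unfolding factor_exponents_def e_def[symmetric] mem_Collect_eq
    using v p(2) e by (metis of_nat_in_Nats)
qed

theorem theorem23:
  fixes d :: nat
  assumes "d \<ge> 3"
  shows "asymp_critical_exponent (fixed_word d) =
    ereal (1 + 1 / (3 - spectral_radius (incidence_matrix d (phi d))))"
proof -
  define s where "s = fixed_word d"
  obtain L where L: "2 < L" "L < 3" "(L - 2) * weight L (d - 1) = 1"
    using assms by (rule weight_root_exists)
  interpret phi_fixed_point d "snth s"
    unfolding s_def using assms by (rule fixed_word_phi_fixed_point)
  interpret phi_weight d "snth s" L
    using L by unfold_locales
  define l where "l = 3 - L"
  have l: "0 < l" using L by (simp add: l_def)
  define E where "E n = (SUP e \<in> factor_exponents n s. ereal (of_rat e))" for n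
  \<comment> \<open>The additive constant of \<open>match_length_le\<close> gets divided by the
    period and fades out as \<open>n\<close> grows.\<close>
  have upper: "\<exists>K\<ge>0. \<forall>n>0. E n \<le> ereal (1 + (1 + \<epsilon>) / l + K / real n)" if \<epsilon>: "0 < \<epsilon>" for \<epsilon>
  proof -
    obtain K where K: "0 \<le> K" "\<And>a b m. a < b \<Longrightarrow> (\<And>i. i < m \<Longrightarrow> s !! (a + i) = s !! (b + i)) \<Longrightarrow>
       real m \<le> (1 + \<epsilon>) / (3 - L) * real (b - a) + K"
      using \<epsilon> by (rule match_length_le) blast
    have "E n \<le> ereal (1 + (1 + \<epsilon>) / l + K / real n)" if n: "0 < n" for n
      unfolding E_def
    proof (rule SUP_least)
      fix e assume "e \<in> factor_exponents n s"
      then obtain a p m where p: "0 < p" "n \<le> p" and e: "of_rat e \<le> 1 + real m / real p"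
        and match: "\<And>i. i < m \<Longrightarrow> s !! (a + i) = s !! (a + p + i)"
        by (rule factor_exponentE) blast
      have "real m \<le> (1 + \<epsilon>) / l * real p + K"
        using K(2)[of a "a + p" m] match p by (simp add: l_def)
      then have "real m / real p \<le> (1 + \<epsilon>) / l + K / real p"
        using p by (simp add: divide_le_eq distrib_right)
      also have "K / real p \<le> K / real n" using K p n by (intro divide_left_mono) auto
      finally show "ereal (of_rat e) \<le> ereal (1 + (1 + \<epsilon>) / l + K / real n)" using e by simp
    qed
    with K(1) show ?thesis by blast
  qed
  have lower: "ereal (1 + 1 / l) \<le> E n" for n
  proof (rule ccontr)
    assume "\<not> ereal (1 + 1 / l) \<le> E n"
    then have "E n < ereal (1 + 1 / l)" by (simp only: not_le)
    then obtain r where r: "E n < ereal r" "ereal r < ereal (1 + 1 / l)"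
      using ereal_dense2 by blast
    from r(2) have "r < 1 + 1 / l" by simp
    note r = r(1) this
    \<comment> \<open>By \<open>g_eq\<close> the gap between \<open>l * (r - 1)\<close> and 1 is
      \<open>2 * g\<close>. One half absorbs \<epsilon>, the other absorbs \<open>K\<close> once the
      period is at least \<open>M\<close>.\<close>
    define g where "g = l * (1 + 1 / l - r) / 2"
    have g: "0 < g" using r l by (simp add: g_def)
    have g_eq: "l * (r - 1) = 1 - 2 * g" using l by (simp add: g_def field_simps)
    define \<epsilon> where "\<epsilon> = min (1 / 2) (g)"
    have \<epsilon>: "0 < \<epsilon>" "\<epsilon> < 1" using g by (auto simp: \<epsilon>_def)
    have \<epsilon>_le: "\<epsilon> \<le> g" unfolding \<epsilon>_def by (rule min.cobounded2)
    obtain K where K: "0 \<le> K" "\<And>N. \<exists>a b m. a < b \<and> N \<le> b - a \<and> (\<forall>i<m. s !! (a + i) = s !! (b + i)) \<and>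
       (1 - \<epsilon>) * real (b - a) \<le> (3 - L) * real m + K"
      using \<epsilon> by (rule long_matches) blast
    obtain M :: nat where M: "K < real M * (g)"
      using reals_Archimedean3[of g] g by blast
    obtain a b m where ab: "a < b" "max n M \<le> b - a" "\<forall>i<m. s !! (a + i) = s !! (b + i)"
       "(1 - \<epsilon>) * real (b - a) \<le> l * real m + K"
      using K(2)[of "max n M"] unfolding l_def by blast
    define p where "p = b - a"
    have p: "0 < p" "n \<le> p" "M \<le> p" "b = a + p" using ab by (auto simp: p_def)
    have "1 + of_nat m / of_nat p \<in> factor_exponents n s"
      using p ab(3) by (intro factor_exponentI) auto
    then have "ereal (of_rat (1 + of_nat m / of_nat p)) \<le> E n"
      unfolding E_def by (rule SUP_upper)
    then have "ereal (of_rat (1 + of_nat m / of_nat p)) < ereal r" using r(1) by (rule le_less_trans)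
    then have "1 + real m / real p < r" by (simp add: of_rat_add of_rat_divide)
    then have "real m < (r - 1) * real p" using p(1) by (simp add: field_simps)
    then have "l * real m < l * ((r - 1) * real p)" using l by simp
    also have "\<dots> = (1 - 2 * g) * real p" unfolding g_eq[symmetric] by simp
    finally have "l * real m + 2 * (g * real p) < real p" by (simp add: algebra_simps)
    moreover have "\<epsilon> * real p \<le> g * real p"
      using \<epsilon>_le by (intro mult_right_mono) auto
    moreover have "real M * g \<le> real p * g"
      using p g by (intro mult_right_mono) auto
    ultimately show False using ab(4) M unfolding p_def[symmetric]
      by (simp add: algebra_simps)
  qed
  have "E \<longlonglongrightarrow> ereal (1 + 1 / l)"
  proof (rule order_tendstoI)
    fix x assume "x < ereal (1 + 1 / l)"
    then show "\<forall>\<^sub>F n in sequentially. x < E n"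
      using lower less_le_trans by (intro always_eventually) blast
  next
    fix x assume "ereal (1 + 1 / l) < x"
    then obtain r where r: "1 + 1 / l < r" "ereal r < x"
      using ereal_dense2[of "ereal (1 + 1 / l)" x] by auto
    define t where "t = r - (1 + 1 / l)"
    have t: "0 < t" using r(1) by (simp add: t_def)
    \<comment> \<open>This makes \<open>\<epsilon> / l\<close> half of the gap \<open>t\<close>,
      leaving the other half for \<open>K / real n\<close>.\<close>
    define \<epsilon> where "\<epsilon> = l * t / 2"
    have \<epsilon>: "0 < \<epsilon>" using t l by (simp add: \<epsilon>_def)
    obtain K where K: "0 \<le> K" "\<And>n. 0 < n \<Longrightarrow> E n \<le> ereal (1 + (1 + \<epsilon>) / l + K / real n)"
      using upper[OF \<epsilon>] by blast
    have "1 + (1 + \<epsilon>) / l + 0 = 1 + 1 / l + t / 2"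
      using l by (simp add: \<epsilon>_def add_divide_distrib)
    also have "\<dots> < r" using t t_def by linarith
    finally have "1 + (1 + \<epsilon>) / l + 0 < r" .
    moreover have "(\<lambda>n. 1 + (1 + \<epsilon>) / l + K / real n) \<longlonglongrightarrow> 1 + (1 + \<epsilon>) / l + 0"
      by (intro tendsto_intros lim_const_over_n)
    ultimately have "\<forall>\<^sub>F n in sequentially. 1 + (1 + \<epsilon>) / l + K / real n < r"
      by (intro order_tendstoD(2))
    then show "\<forall>\<^sub>F n in sequentially. E n < x"
      using eventually_gt_at_top[of 0]
    proof eventually_elim
      case (elim n)
      have "E n \<le> ereal (1 + (1 + \<epsilon>) / l + K / real n)" using elim(2) by (rule K(2))
      also have "\<dots> < ereal r" using elim(1) by simp
      finally show ?case using r(2) by simp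
    qed
  qed
  then have "lim E = ereal (1 + 1 / l)" by (rule limI)
  \<comment> \<open>Finiteness selects the limit in \<open>asymp_critical_exponent\<close>; the
    bound for \<open>n = 1\<close> suffices, as the repeated word is never empty.\<close>
  moreover have "critical_exponent s \<noteq> \<infinity>"
  proof -
    obtain K where "E 1 \<le> ereal (1 + (1 + 1) / l + K / real 1)"
      using upper[of 1] by auto
    moreover have "factor_exponents 0 s = factor_exponents 1 s"
      by (auto simp: factor_exponents_def Suc_le_eq)
    ultimately show ?thesis by (auto simp: critical_exponent_def E_def)
  qed
  ultimately show ?thesis
    unfolding asymp_critical_exponent_def s_def[symmetric] spectral_radius_incidence
    by (simp add: E_def[abs_def] l_def)
qed

end
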